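(* Let $r>1$ be an irrational number and let $P_r=\{\lfloor nr\rfloor : n\in\mathbb{Z}\setminus\{0\}\}$. Let $X\subseteq\mathbb{Z}$ be infinite and definable in the structure $(\mathbb{Z},+,P_r)$. Then there is $N=N(X)\in\mathbb{N}_+$ such that for every $x\in X$, at least one of the integers $x+1,x+2,\dots,x+N$ lies in $X$.
   Context: $\lfloor a\rfloor$ denotes the largest integer $\le a$; $\mathbb{N}_+=\{1,2,3,\dots\}$. "Definable" means definable by a first-order formula in the language $\{+,P\}$ (with $P$ interpreted as $P_r$), possibly with parameters from $\mathbb{Z}$. *)

theory Defs
  imports Complex_Main
begin

definition beatty :: "real \<Rightarrow> int set" where
  "beatty r = {\<lfloor>real_of_int n * r\<rfloor> | n :: int. n \<noteq> 0}"

text \<open>First-order logic with equality over the language with a binary function symbol \<open>+\<close> and a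
  unary predicate symbol \<open>P\<close>. Variables are named by natural numbers; the remaining connectives
  and the universal quantifier are classically expressible by those below.\<close>

datatype tm = Var nat | Plus tm tm

datatype fm =
    Eq tm tm
  | Pred tm
  | Neg fm
  | Conj fm fm
  | Exists nat fm

primrec eval :: "(nat \<Rightarrow> int) \<Rightarrow> tm \<Rightarrow> int" where
  "eval e (Var i) = e i"
| "eval e (Plus s t) = eval e s + eval e t"

primrec sat :: "int set \<Rightarrow> (nat \<Rightarrow> int) \<Rightarrow> fm \<Rightarrow> bool" where
  "sat P e (Eq s t) \<longleftrightarrow> eval e s = eval e t"
| "sat P e (Pred t) \<longleftrightarrow> eval e t \<in> P"
| "sat P e (Neg \<phi>) \<longleftrightarrow> \<not> sat P e \<phi>"
| "sat P e (Conj \<phi> \<psi>) \<longleftrightarrow> sat P e \<phi> \<and> sat P e \<psi>"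
| "sat P e (Exists i \<phi>) \<longleftrightarrow> (\<exists>a. sat P (e(i := a)) \<phi>)"

text \<open>Definability with parameters in the structure \<open>(\<int>, +, P)\<close>: variable 0 is the argument,
  and the assignment \<open>e\<close> supplies the parameters as the values of the other free variables, of
  which a formula has only finitely many.\<close>

definition definable :: "int set \<Rightarrow> int set \<Rightarrow> bool" where
  "definable P X \<longleftrightarrow> (\<exists>\<phi> e. X = {x. sat P (e(0 := x)) \<phi>})"

end

theory Submission
  imports Defs "HOL-Analysis.Kronecker_Approximation_Theorem"
begin

text \<open>Put \<open>\<alpha> = 1/r\<close>. The map \<open>x \<mapsto> frac (\<alpha> x)\<close> embeds \<open>\<int>\<close> into the dense subgroup
  \<open>\<Gamma> = \<int> + \<int>\<alpha>\<close> of \<open>\<real>\<close>; addition becomes addition modulo 1, and \<open>x\<close> lies in \<open>P\<^sub>r\<close> iff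
  \<open>frac (\<alpha> x) > 1 - \<alpha>\<close>. A back-and-forth argument for \<open>\<Gamma>\<close> as an ordered group shows that the
  truth value of a formula depends only on the signs of finitely many integer linear combinations
  of \<open>1\<close>, \<open>\<alpha>\<close> and the values \<open>frac (\<alpha> x\<^sub>i)\<close>, together with these values modulo \<open>M \<Gamma>\<close> for some
  \<open>M > 0\<close>. For fixed parameters the signs change at finitely many points only, so an infinite
  definable set \<open>X\<close> contains some \<open>x\<^sub>0\<close> away from these points, hence also all \<open>x\<close> with
  \<open>\<alpha> (x - x\<^sub>0)\<close> close to \<open>M h\<close> for an integer \<open>h\<close> and \<open>x \<equiv> x\<^sub>0\<close> modulo \<open>M\<close>. Such
  \<open>x\<close> occur with bounded gaps.\<close>

section \<open>Back and forth in a dense ordered group\<close>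

definition lincomb :: "'i set \<Rightarrow> ('i \<Rightarrow> int) \<Rightarrow> ('i \<Rightarrow> real) \<Rightarrow> real" where
  "lincomb S k v = (\<Sum>i\<in>S. of_int (k i) * v i)"

text \<open>Signs of combinations with coefficients up to \<open>N\<close> record the order type.
  The congruence clause is there because a dense group such as \<int> + \<int>\<alpha> is not
  divisible: signs alone do not show whether a combination can be divided by an integer inside the
  group.\<close>

definition similar ::
  "real set \<Rightarrow> int \<Rightarrow> int \<Rightarrow> 'i set \<Rightarrow> ('i \<Rightarrow> real) \<Rightarrow> ('i \<Rightarrow> real) \<Rightarrow> bool" where
  "similar \<Gamma> N M S v v' \<longleftrightarrow>
     (\<forall>k. (\<forall>i\<in>S. \<bar>k i\<bar> \<le> N) \<longrightarrow> sgn (lincomb S k v) = sgn (lincomb S k v')) \<and>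
     (\<forall>i\<in>S. \<exists>g\<in>\<Gamma>. v i - v' i = of_int M * g)"

lemma lincomb_cong:
  "(\<And>i. i \<in> S \<Longrightarrow> k i = l i) \<Longrightarrow> (\<And>i. i \<in> S \<Longrightarrow> v i = w i) \<Longrightarrow> lincomb S k v = lincomb S l w"
  by (simp add: lincomb_def)

lemma lincomb_insert:
  "finite S \<Longrightarrow> j \<notin> S \<Longrightarrow> lincomb (insert j S) k v = of_int (k j) * v j + lincomb S k v"
  by (simp add: lincomb_def)

lemma lincomb_fun_upd: "j \<notin> S \<Longrightarrow> lincomb S k (v(j := w)) = lincomb S k v"
  by (rule lincomb_cong) auto

lemma lincomb_diff_coeff:
  "lincomb S (\<lambda>i. a * k i - b * l i) v = of_int a * lincomb S k v - of_int b * lincomb S l v"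
  by (simp add: lincomb_def sum_distrib_left algebra_simps sum_subtractf)

lemma lincomb_uminus_coeff: "lincomb S (\<lambda>i. - k i) v = - lincomb S k v"
  by (simp add: lincomb_def sum_negf)

lemma finite_lincombs:
  assumes "finite S"
  shows "finite {lincomb S k v | k. \<forall>i\<in>S. \<bar>k i\<bar> \<le> N}"
proof (rule finite_subset)
  show "{lincomb S k v | k. \<forall>i\<in>S. \<bar>k i\<bar> \<le> N} \<subseteq>
        (\<lambda>k. lincomb S k v) ` (S \<rightarrow>\<^sub>E {-N..N})"
  proof clarify
    fix k assume "\<forall>i\<in>S. \<bar>k i\<bar> \<le> N"
    then have "restrict k S \<in> S \<rightarrow>\<^sub>E {-N..N}"
      by (auto simp: abs_le_iff)
    moreover have "lincomb S k v = lincomb S (restrict k S) v"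
      by (rule lincomb_cong) auto
    ultimately show "lincomb S k v \<in> (\<lambda>k. lincomb S k v) ` (S \<rightarrow>\<^sub>E {-N..N})"
      by blast
  qed
qed (use assms in \<open>auto intro!: finite_PiE\<close>)

lemma similar_mono:
  assumes sim: "similar \<Gamma> N M S v v'" and "N' \<le> N" "M' dvd M" "T \<subseteq> S" "finite S"
    and mult: "\<And>g n. g \<in> \<Gamma> \<Longrightarrow> of_int n * g \<in> \<Gamma>" and "0 \<le> N"
  shows "similar \<Gamma> N' M' T v v'"
  unfolding similar_def
proof (intro conjI allI impI ballI)
  fix k :: "'a \<Rightarrow> int" assume k: "\<forall>i\<in>T. \<bar>k i\<bar> \<le> N'"
  define l where "l i = (if i \<in> T then k i else 0)" for i
  have l: "lincomb S l u = lincomb T k u" for u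
    unfolding lincomb_def using assms(4,5)
    by (intro sum.mono_neutral_cong_right) (auto simp: l_def)
  have "\<forall>i\<in>S. \<bar>l i\<bar> \<le> N"
    using k assms by (force simp: l_def)
  then have "sgn (lincomb S l v) = sgn (lincomb S l v')"
    using sim unfolding similar_def by blast
  then show "sgn (lincomb T k v) = sgn (lincomb T k v')"
    by (simp add: l)
next
  fix i assume "i \<in> T"
  then obtain g where g: "g \<in> \<Gamma>" "v i - v' i = of_int M * g"
    using sim assms(4) unfolding similar_def by blast
  obtain d where "M = M' * d" using assms(3) by blast
  then have "v i - v' i = of_int M' * (of_int d * g)" using g by simp
  then show "\<exists>g\<in>\<Gamma>. v i - v' i = of_int M' * g" using mult[OF g(1)] by blast
qed

text \<open>Serves to find a nonempty open gap: a dense set meets it, and every point of it lies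
  strictly above \<open>A\<close> and strictly below \<open>B\<close>. An empty side gets an
  arbitrary margin.\<close>

lemma finite_sets_separated:
  fixes A B :: "real set"
  assumes "finite A" "finite B" and "\<And>a b. a \<in> A \<Longrightarrow> b \<in> B \<Longrightarrow> a < b"
  obtains p q where "p < q" "\<And>a. a \<in> A \<Longrightarrow> a \<le> p" "\<And>b. b \<in> B \<Longrightarrow> q \<le> b"
proof -
  consider "A = {}" "B = {}" | "A = {}" "B \<noteq> {}" | "A \<noteq> {}" "B = {}" | "A \<noteq> {}" "B \<noteq> {}"
    by blast
  then show ?thesis
  proof cases
    case 1 then show ?thesis using that[of 0 1] by simp
  next
    case 2 then show ?thesis using assms by (intro that[of "Min B - 1" "Min B"]) (auto simp del: Min_gr_iff)
  next
    case 3 then show ?thesis using assms by (intro that[of "Max A" "Max A + 1"]) (auto simp del: Max_less_iff)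
  next
    case 4 then show ?thesis using that[of "Max A" "Min B"] assms by simp
  qed
qed

lemma sgn_mult_diff_pos:
  fixes a b c :: real
  assumes "0 < a"
  shows "sgn (a * b + c) = sgn (b - - c / a)"
proof -
  have "a * b + c = a * (b - - c / a)" using assms by (simp add: field_simps)
  then show ?thesis using assms by (simp only: sgn_mult) simp
qed

text \<open>Reduces adding a coordinate to locating \<open>w\<close> relative to cut points -L/m. A
  zero coefficient at \<open>j\<close> falls under the old similarity, a positive one is divided
  out, and a negative one becomes positive on negating all coefficients, which keeps the bound
  \<open>N\<close>.\<close>

lemma similar_insertI:
  fixes v v' :: "'i \<Rightarrow> real"
  assumes S: "finite S" "j \<notin> S" and sim: "similar \<Gamma> N M S v v'"
    and g: "g \<in> \<Gamma>" "w - w' = of_int M * g"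
    and sgn: "\<And>k m. (\<forall>i\<in>S. \<bar>k i\<bar> \<le> N) \<Longrightarrow> 0 < m \<Longrightarrow> m \<le> N \<Longrightarrow>
      sgn (w - - lincomb S k v / of_int m) = sgn (w' - - lincomb S k v' / of_int m)"
  shows "similar \<Gamma> N M (insert j S) (v(j := w)) (v'(j := w'))"
  unfolding similar_def
proof (intro conjI allI impI ballI)
  fix k :: "'i \<Rightarrow> int" assume k: "\<forall>i\<in>insert j S. \<bar>k i\<bar> \<le> N"
  have L: "lincomb (insert j S) k (u(j := x)) = of_int (k j) * x + lincomb S k u" for u x
    using S by (simp add: lincomb_insert lincomb_fun_upd)
  consider "k j = 0" | "k j > 0" | "k j < 0" by linarith
  then show "sgn (lincomb (insert j S) k (v(j := w))) = sgn (lincomb (insert j S) k (v'(j := w')))"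
  proof cases
    case 1
    then show ?thesis using sim k by (simp add: L similar_def)
  next
    case 2
    then show ?thesis
      unfolding L using sgn[of k "k j"] k by (simp add: sgn_mult_diff_pos)
  next
    case 3
    have "sgn (- (of_int (k j) * w + lincomb S k v)) = sgn (- (of_int (k j) * w' + lincomb S k v'))"
      using sgn[of "\<lambda>i. - k i" "- k j"] k 3
        sgn_mult_diff_pos[of "- of_int (k j)" w "- lincomb S k v"]
        sgn_mult_diff_pos[of "- of_int (k j)" w' "- lincomb S k v'"]
      by (simp add: lincomb_uminus_coeff)
    then show ?thesis unfolding L by (simp only: sgn_minus neg_equal_iff_equal)
  qed
next
  fix i assume "i \<in> insert j S"
  then show "\<exists>g\<in>\<Gamma>. (v(j := w)) i - (v'(j := w')) i = of_int M * g"
    using g sim S by (cases "i = j") (auto simp: similar_def)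
qed

text \<open>Multiplying the difference of two cut points by m n > 0 gives a combination with
  coefficients m l - n k, of absolute value at most 2 N N. This is the source of the bound in the
  hypothesis.\<close>

lemma sgn_cut_diff:
  assumes sim: "similar \<Gamma> (2 * N * N) M S v v'"
    and k: "\<forall>i\<in>S. \<bar>k i\<bar> \<le> N" "0 < m" "m \<le> N" and l: "\<forall>i\<in>S. \<bar>l i\<bar> \<le> N" "0 < n" "n \<le> N"
  shows "sgn (- lincomb S k v / of_int m - - lincomb S l v / of_int n) =
         sgn (- lincomb S k v' / of_int m - - lincomb S l v' / of_int n)"
proof -
  have *: "sgn (- lincomb S k u / of_int m - - lincomb S l u / of_int n) =
        sgn (lincomb S (\<lambda>i. m * l i - n * k i) u)" for u
  proof -
    have "lincomb S (\<lambda>i. m * l i - n * k i) u =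
        of_int (m * n) * (- lincomb S k u / of_int m - - lincomb S l u / of_int n)"
      unfolding lincomb_diff_coeff using k l by (simp add: field_simps)
    moreover have "0 < real_of_int (m * n)" using k l by simp
    ultimately show ?thesis by (simp only: sgn_mult) simp
  qed
  have "\<bar>m * l i - n * k i\<bar> \<le> 2 * N * N" if "i \<in> S" for i
  proof -
    have "\<bar>m * l i\<bar> \<le> N * N" "\<bar>n * k i\<bar> \<le> N * N"
      unfolding abs_mult using k l that by (auto intro!: mult_mono)
    then show ?thesis by linarith
  qed
  then show ?thesis
    unfolding * using sim by (simp add: similar_def)
qed

text \<open>By \<open>sgn_cut_diff\<close> the finitely many cut points of \<open>v\<close> and
  \<open>v'\<close> are ordered alike. If \<open>w\<close> is a cut point, \<open>w'\<close> has to
  be the matching one; otherwise the density of the coset of \<open>w\<close> modulo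
  \<open>M\<close> times \<Gamma> provides \<open>w'\<close> in the matching gap.\<close>

lemma back_and_forth:
  fixes v v' :: "'i \<Rightarrow> real"
  assumes S: "finite S" "j \<notin> S" and N: "1 \<le> N" and M: "0 < M"
    and sim: "similar \<Gamma> (2 * N * N) (M * fact (nat N)) S v v'"
    and zero: "0 \<in> \<Gamma>" and add: "\<And>g h. g \<in> \<Gamma> \<Longrightarrow> h \<in> \<Gamma> \<Longrightarrow> g + h \<in> \<Gamma>"
    and mult: "\<And>g n. g \<in> \<Gamma> \<Longrightarrow> of_int n * g \<in> \<Gamma>"
    and dense: "\<And>p q. p < q \<Longrightarrow> \<exists>g\<in>\<Gamma>. p < w - of_int M * g \<and> w - of_int M * g < q"
  obtains w' g where "g \<in> \<Gamma>" "w - w' = of_int M * g"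
    "similar \<Gamma> N M (insert j S) (v(j := w)) (v'(j := w'))"
proof -
  have simNM: "similar \<Gamma> N M S v v'"
    using similar_mono[OF sim _ _ _ S(1) mult, of N M S] N by (simp add: mult_le_cancel_right1)
  \<comment> \<open>Coefficient functions are extensional outside \<open>S\<close>, which makes
    \<open>Q\<close> finite; arbitrary ones are restricted to \<open>S\<close> in
    \<open>suff\<close>.\<close>
  define Q where "Q = (S \<rightarrow>\<^sub>E {-N..N}) \<times> {1..N}"
  define cut where "cut u p = - lincomb S (fst p) u / of_int (snd p)" for u :: "'i \<Rightarrow> real" and p
  have finQ: "finite Q"
    unfolding Q_def using S by (auto intro!: finite_PiE)
  have Q: "(\<forall>i\<in>S. \<bar>fst p i\<bar> \<le> N)" "0 < snd p" "snd p \<le> N" if "p \<in> Q" for p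
    using that by (force simp: Q_def abs_le_iff PiE_iff)+
  have cuts: "sgn (cut v p - cut v q) = sgn (cut v' p - cut v' q)" if "p \<in> Q" "q \<in> Q" for p q
    unfolding cut_def using sgn_cut_diff[OF sim Q[OF that(1)] Q[OF that(2)]] .
  note result = that
  have suff: thesis if g: "g \<in> \<Gamma>" "w - w' = of_int M * g"
    and s: "\<And>p. p \<in> Q \<Longrightarrow> sgn (w - cut v p) = sgn (w' - cut v' p)" for g w'
  proof (rule result[OF g similar_insertI[OF S simNM g]])
    fix k :: "'i \<Rightarrow> int" and m assume k: "\<forall>i\<in>S. \<bar>k i\<bar> \<le> N" and m: "0 < m" "m \<le> N"
    have "(restrict k S, m) \<in> Q"
      using k m by (auto simp: Q_def abs_le_iff)
    moreover have "cut u (restrict k S, m) = - lincomb S k u / of_int m" for u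
      unfolding cut_def using lincomb_cong[of S "restrict k S" k u u] by simp
    ultimately show "sgn (w - - lincomb S k v / of_int m) = sgn (w' - - lincomb S k v' / of_int m)"
      using s by metis
  qed
  show thesis
  proof (cases "w \<in> cut v ` Q")
    case True
    then obtain p where p: "p \<in> Q" "w = cut v p" by blast
    define k m where "k = fst p" and "m = snd p"
    have m: "0 < m" "m \<le> N" using Q[OF p(1)] by (auto simp: m_def)
    text \<open>The factor \<open>N!\<close> in the modulus makes the matching cut divisible by \<open>m\<close> in \<open>\<Gamma>\<close>.\<close>
    have "\<exists>g. \<forall>i\<in>S. g i \<in> \<Gamma> \<and> v i - v' i = of_int (M * fact (nat N)) * g i"
      using sim unfolding similar_def by metis
    then obtain g where g: "\<And>i. i \<in> S \<Longrightarrow> g i \<in> \<Gamma>"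
      "\<And>i. i \<in> S \<Longrightarrow> v i - v' i = of_int (M * fact (nat N)) * g i" by blast
    have "int (nat m) dvd int (fact (nat N))"
      unfolding int_dvd_int_iff using m by (intro dvd_fact) auto
    then obtain d where d: "fact (nat N) = m * d"
      using m by (auto simp: dvd_def)
    \<comment> \<open>Here \<open>d\<close> is N!/m, and the minus sign comes from the form -L/m of
      the cut point.\<close>
    define h where "h = (\<Sum>i\<in>S. of_int (- d * k i) * g i)"
    have sum_in: "(\<Sum>i\<in>T. of_int (c i) * g i) \<in> \<Gamma>" if "T \<subseteq> S" for T c
      using finite_subset[OF that S(1)] that
      by (induction T rule: finite_induct) (auto intro: zero add mult g(1))
    have "lincomb S k v - lincomb S k v' = (\<Sum>i\<in>S. of_int (k i) * (v i - v' i))"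
      by (simp add: lincomb_def sum_subtractf algebra_simps)
    also have "\<dots> = (\<Sum>i\<in>S. of_int (k i) * (of_int (M * fact (nat N)) * g i))"
      by (intro sum.cong) (auto simp only: g)
    also have "\<dots> = - (of_int m * (of_int M * h))"
      unfolding d h_def by (simp add: sum_distrib_left sum_negf algebra_simps)
    finally have "w - cut v' p = of_int M * h"
      unfolding p(2) cut_def k_def[symmetric] m_def[symmetric] using m by (simp add: field_simps)
    moreover have "h \<in> \<Gamma>" unfolding h_def by (rule sum_in) simp
    ultimately show thesis
      using cuts p by (intro suff[of h "cut v' p"]) auto
  next
    case False
    define A where "A = {p \<in> Q. cut v p < w}"
    define B where "B = {p \<in> Q. w < cut v p}"
    have AB: "A \<subseteq> Q" "B \<subseteq> Q" "Q \<subseteq> A \<union> B"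
      using False by (force simp: A_def B_def)+
    have less: "cut v' a < cut v' b" if "a \<in> A" "b \<in> B" for a b
    proof -
      have "sgn (cut v a - cut v b) = - 1" using that by (simp add: A_def B_def)
      then have "sgn (cut v' a - cut v' b) = - 1"
        using cuts[OF subsetD[OF AB(1) that(1)] subsetD[OF AB(2) that(2)]] by simp
      then show ?thesis by (simp add: sgn_if split: if_splits)
    qed
    have "finite (cut v' ` A)" "finite (cut v' ` B)"
      using finQ AB by (auto intro: finite_subset)
    then obtain p q where "p < q" "\<And>a. a \<in> cut v' ` A \<Longrightarrow> a \<le> p" "\<And>b. b \<in> cut v' ` B \<Longrightarrow> q \<le> b"
      by (rule finite_sets_separated) (use less in blast)+
    then have pq: "p < q" "\<And>a. a \<in> A \<Longrightarrow> cut v' a \<le> p" "\<And>b. b \<in> B \<Longrightarrow> q \<le> cut v' b"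
      by auto
    obtain g where g: "g \<in> \<Gamma>" "p < w - of_int M * g" "w - of_int M * g < q"
      using dense[OF pq(1)] by blast
    show thesis
    proof (rule suff[OF g(1), of "w - of_int M * g"])
      fix c assume "c \<in> Q"
      then consider "c \<in> A" | "c \<in> B" using AB by blast
      then show "sgn (w - cut v c) = sgn (w - of_int M * g - cut v' c)"
      proof cases
        case 1 then show ?thesis using pq(2)[of c] g by (simp add: A_def)
      next
        case 2 then show ?thesis using pq(3)[of c] g by (simp add: B_def)
      qed
    qed simp
  qed
qed

section \<open>Formulas and linear combinations of fractional parts\<close>

primrec term_vars :: "tm \<Rightarrow> nat set" where
  "term_vars (Var i) = {i}"
| "term_vars (Plus s t) = term_vars s \<union> term_vars t"

primrec vars :: "fm \<Rightarrow> nat set" where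
  "vars (Eq s t) = term_vars s \<union> term_vars t"
| "vars (Pred t) = term_vars t"
| "vars (Neg \<phi>) = vars \<phi>"
| "vars (Conj \<phi> \<psi>) = vars \<phi> \<union> vars \<psi>"
| "vars (Exists i \<phi>) = insert i (vars \<phi>)"

primrec mult_of :: "tm \<Rightarrow> nat \<Rightarrow> int" where
  "mult_of (Var j) i = (if i = j then 1 else 0)"
| "mult_of (Plus s t) i = mult_of s i + mult_of t i"

lemma finite_term_vars: "finite (term_vars t)"
  by (induction t) auto

lemma finite_vars: "finite (vars \<phi>)"
  by (induction \<phi>) (auto simp: finite_term_vars)

lemma eval_eq_sum:
  assumes "finite V" "term_vars t \<subseteq> V"
  shows "eval e t = (\<Sum>i\<in>V. mult_of t i * e i)"
  using assms(2)
proof (induction t)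
  case (Var j)
  have "(\<Sum>i\<in>V. mult_of (Var j) i * e i) = (\<Sum>i\<in>V. if i = j then e i else 0)"
    by (intro sum.cong) auto
  then show ?case using Var assms(1) by simp
qed (auto simp: sum.distrib algebra_simps)

text \<open>Indices 0 and 1 are reserved for the constants \<open>1\<close> and \<open>\<alpha>\<close>, see \<open>lift\<close> below;
  variable \<open>i\<close> of a formula is stored at \<open>i + 2\<close>.\<close>

definition slots :: "nat set \<Rightarrow> nat set" where
  "slots V = insert 0 (insert 1 ((\<lambda>i. i + 2) ` V))"

lemma finite_slots: "finite V \<Longrightarrow> finite (slots V)"
  by (simp add: slots_def)

section \<open>The dense group of the rotation and the lift of integers to it\<close>

locale irrational_rotation =
  fixes \<alpha> :: real
  assumes irrational: "\<alpha> \<notin> \<rat>"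
begin

definition \<Gamma> :: "real set" where
  "\<Gamma> = {of_int a * \<alpha> + of_int b | a b. True}"

definition lift :: "(nat \<Rightarrow> int) \<Rightarrow> nat \<Rightarrow> real" where
  "lift e = case_nat 1 (case_nat \<alpha> (\<lambda>i. frac (\<alpha> * of_int (e i))))"

lemma \<Gamma>I: "of_int a * \<alpha> + of_int b \<in> \<Gamma>"
  by (auto simp: \<Gamma>_def)

lemma \<Gamma>_zero: "0 \<in> \<Gamma>"
  using \<Gamma>I[of 0 0] by simp

lemma \<Gamma>_add:
  assumes "g \<in> \<Gamma>" "h \<in> \<Gamma>"
  shows "g + h \<in> \<Gamma>"
proof -
  obtain a b c d where "g = of_int a * \<alpha> + of_int b" "h = of_int c * \<alpha> + of_int d"
    using assms by (auto simp: \<Gamma>_def)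
  then have "g + h = of_int (a + c) * \<alpha> + of_int (b + d)" by (simp add: algebra_simps)
  then show ?thesis using \<Gamma>I by metis
qed

lemma \<Gamma>_mult:
  assumes "g \<in> \<Gamma>"
  shows "of_int n * g \<in> \<Gamma>"
proof -
  obtain a b where "g = of_int a * \<alpha> + of_int b"
    using assms by (auto simp: \<Gamma>_def)
  then have "of_int n * g = of_int (n * a) * \<alpha> + of_int (n * b)" by (simp add: algebra_simps)
  then show ?thesis using \<Gamma>I by metis
qed

text \<open>Since \<alpha> is irrational, the numbers k \<alpha> - h are dense in the reals.
  Approximating (w - c)/M, with c the midpoint of p and q, to within half the interval length over
  \<open>M\<close> gives the required element.\<close>

lemma \<Gamma>_dense:
  assumes "0 < M" "p < q"
  shows "\<exists>g\<in>\<Gamma>. p < w - of_int M * g \<and> w - of_int M * g < q"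
proof -
  define \<epsilon> where "\<epsilon> = (q - p) / 2 / of_int M"
  have "\<epsilon> > 0" using assms by (simp add: \<epsilon>_def)
  then obtain h k where hk: "\<bar>of_int k * \<alpha> - of_int h - (w - (p + q) / 2) / of_int M\<bar> < \<epsilon>"
    using sequence_of_fractional_parts_is_dense[OF irrational] by metis
  define g where "g = of_int k * \<alpha> + of_int (- h)"
  have "\<bar>of_int M * (g - (w - (p + q) / 2) / of_int M)\<bar> < of_int M * \<epsilon>"
    unfolding abs_mult using hk assms by (simp add: g_def)
  then have "\<bar>of_int M * g - (w - (p + q) / 2)\<bar> < (q - p) / 2"
    using assms by (simp only: \<epsilon>_def right_diff_distrib) simp
  then have "p < w - of_int M * g \<and> w - of_int M * g < q"
    unfolding abs_less_iff by argo
  then show ?thesis using \<Gamma>I[of k "-h"] by (auto simp: g_def)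
qed

lemma int_multiple_in_Ints_iff: "\<alpha> * of_int n \<in> \<int> \<longleftrightarrow> n = 0"
proof
  assume "\<alpha> * of_int n \<in> \<int>"
  then obtain z where z: "\<alpha> * of_int n = of_int z" by (auto elim: Ints_cases)
  show "n = 0"
  proof (rule ccontr)
    assume "n \<noteq> 0"
    then have "\<alpha> = of_int z / of_int n" using z by (simp add: field_simps)
    then show False using irrational by simp
  qed
qed simp

text \<open>Ensures that finitely many exceptional fractional parts come from only finitely many
  integers.\<close>

lemma inj_frac_multiple: "inj (\<lambda>x. frac (\<alpha> * real_of_int x))"
proof
  fix x y :: int assume "frac (\<alpha> * of_int x) = frac (\<alpha> * of_int y)"
  then have "\<alpha> * of_int (x - y) = of_int (\<lfloor>\<alpha> * of_int x\<rfloor> - \<lfloor>\<alpha> * of_int y\<rfloor>)"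
    by (simp add: frac_def algebra_simps)
  then have "\<alpha> * of_int (x - y) \<in> \<int>" by (metis Ints_of_int)
  then show "x = y" unfolding int_multiple_in_Ints_iff by simp
qed

lemma lift_fun_upd: "lift (e(i := x)) = (lift e)(i + 2 := frac (\<alpha> * of_int x))"
  by (rule ext) (auto simp: lift_def split: nat.split)

section \<open>Atomic formulas as sign conditions on fractional parts\<close>

lemma lincomb_lift:
  assumes "finite V"
  shows "lincomb (slots V) (case_nat a (case_nat b d)) (lift e) =
    of_int a + of_int b * \<alpha> + (\<Sum>i\<in>V. of_int (d i) * frac (\<alpha> * of_int (e i)))"
proof -
  have "(0::nat) \<notin> insert 1 ((\<lambda>i. i + 2) ` V)" "(1::nat) \<notin> (\<lambda>i. i + 2) ` V" by auto
  moreover have "(\<Sum>i\<in>(\<lambda>i. i + 2) ` V. of_int (case_nat a (case_nat b d) i) * lift e i) =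
      (\<Sum>i\<in>V. of_int (d i) * frac (\<alpha> * of_int (e i)))"
    by (subst sum.reindex) (auto simp: lift_def inj_on_def numeral_2_eq_2)
  ultimately show ?thesis
    using assms by (simp add: lincomb_def slots_def) (simp add: lift_def)
qed

lemma frac_sum_diff_in_Ints:
  "\<alpha> * of_int (\<Sum>i\<in>V. d i * e i) - (\<Sum>i\<in>V. of_int (d i) * frac (\<alpha> * of_int (e i))) \<in> \<int>"
proof -
  have "\<alpha> * of_int (\<Sum>i\<in>V. d i * e i) - (\<Sum>i\<in>V. of_int (d i) * frac (\<alpha> * of_int (e i))) =
    (\<Sum>i\<in>V. of_int (d i) * of_int \<lfloor>\<alpha> * of_int (e i)\<rfloor>)"
    by (simp add: frac_def sum_distrib_left sum_subtractf[symmetric] algebra_simps)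
  also have "\<dots> \<in> \<int>" by (intro Ints_sum Ints_mult) auto
  finally show ?thesis .
qed

text \<open>Bounds the integer part of the combination independently of the values
  \<open>x i\<close>, so that the integer shifts in the next two lemmas range over a fixed finite
  set.\<close>

lemma abs_frac_sum_le: "\<bar>\<Sum>i\<in>V. of_int (d i) * frac (x i :: real)\<bar> \<le> of_int (\<Sum>i\<in>V. \<bar>d i\<bar>)"
proof -
  have "\<bar>\<Sum>i\<in>V. of_int (d i) * frac (x i)\<bar> \<le> (\<Sum>i\<in>V. \<bar>of_int (d i) * frac (x i)\<bar>)" by simp
  also have "\<dots> \<le> (\<Sum>i\<in>V. \<bar>of_int (d i)\<bar> * 1)"
    unfolding abs_mult by (intro sum_mono mult_left_mono) (auto simp: less_imp_le[OF frac_lt_1])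
  finally show ?thesis by simp
qed

text \<open>Modulo 1, \<alpha> times the sum equals the combination T of fractional parts, and by
  irrationality it is an integer only if the sum is 0. So the sum vanishes iff T = -n for an integer
  n, which the bound on T limits to finitely many values.\<close>

lemma sum_eq_0_iff:
  fixes d e :: "nat \<Rightarrow> int"
  assumes "finite V"
  shows "(\<Sum>i\<in>V. d i * e i) = 0 \<longleftrightarrow> (\<exists>n. \<bar>n\<bar> \<le> (\<Sum>i\<in>V. \<bar>d i\<bar>) \<and>
    lincomb (slots V) (case_nat n (case_nat 0 d)) (lift e) = 0)"
proof -
  define T where "T = (\<Sum>i\<in>V. of_int (d i) * frac (\<alpha> * of_int (e i)))"
  have diff: "\<alpha> * of_int (\<Sum>i\<in>V. d i * e i) - T \<in> \<int>"
    unfolding T_def by (rule frac_sum_diff_in_Ints)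
  have "(\<Sum>i\<in>V. d i * e i) = 0 \<longleftrightarrow> T \<in> \<int>"
    unfolding int_multiple_in_Ints_iff[symmetric]
    using Ints_diff[OF _ diff] Ints_add[OF _ diff] by fastforce
  also have "\<dots> \<longleftrightarrow> (\<exists>n. \<bar>n\<bar> \<le> (\<Sum>i\<in>V. \<bar>d i\<bar>) \<and> of_int n + T = 0)"
  proof
    assume "T \<in> \<int>"
    then obtain z where z: "T = of_int z" by (auto elim: Ints_cases)
    then have "\<bar>z\<bar> \<le> (\<Sum>i\<in>V. \<bar>d i\<bar>)"
      using abs_frac_sum_le[of d "\<lambda>i. \<alpha> * of_int (e i)" V] unfolding T_def[symmetric] by linarith
    then show "\<exists>n. \<bar>n\<bar> \<le> (\<Sum>i\<in>V. \<bar>d i\<bar>) \<and> of_int n + T = 0"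
      using z by (intro exI[of _ "- z"]) simp
  next
    assume "\<exists>n. \<bar>n\<bar> \<le> (\<Sum>i\<in>V. \<bar>d i\<bar>) \<and> of_int n + T = 0"
    then obtain n where "of_int n + T = 0" by blast
    then have "T = of_int (- n)" by simp
    then show "T \<in> \<int>" by (metis Ints_of_int)
  qed
  finally show ?thesis
    unfolding lincomb_lift[OF assms] T_def[symmetric] by simp
qed

text \<open>The first two sign conditions place n + T in [0,1), that is n = -\<lfloor>T\<rfloor>;
  the third then says that this fractional part exceeds 1 - \<alpha>. With n bounded by the sum plus
  2, the coefficient n - 1 stays within the plus 3 of \<open>case_nat_coeff_bound\<close>.\<close>

lemma frac_sum_gt_iff:
  fixes d e :: "nat \<Rightarrow> int"
  assumes "finite V"
  shows "1 - \<alpha> < frac (\<alpha> * of_int (\<Sum>i\<in>V. d i * e i)) \<longleftrightarrow>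
    (\<exists>n. \<bar>n\<bar> \<le> (\<Sum>i\<in>V. \<bar>d i\<bar>) + 2 \<and>
      0 \<le> lincomb (slots V) (case_nat n (case_nat 0 d)) (lift e) \<and>
      lincomb (slots V) (case_nat (n - 1) (case_nat 0 d)) (lift e) < 0 \<and>
      0 < lincomb (slots V) (case_nat (n - 1) (case_nat 1 d)) (lift e))"
proof -
  define T where "T = (\<Sum>i\<in>V. of_int (d i) * frac (\<alpha> * of_int (e i)))"
  have "\<alpha> * of_int (\<Sum>i\<in>V. d i * e i) - T \<in> \<int>"
    unfolding T_def by (rule frac_sum_diff_in_Ints)
  then obtain z where "\<alpha> * of_int (\<Sum>i\<in>V. d i * e i) - T = of_int z"
    by (rule Ints_cases)
  then have "\<alpha> * of_int (\<Sum>i\<in>V. d i * e i) = of_int z + T" by linarith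
  then have frac: "frac (\<alpha> * of_int (\<Sum>i\<in>V. d i * e i)) = frac T"
    unfolding frac_def by (simp only:) simp
  have bound: "\<bar>T\<bar> \<le> of_int (\<Sum>i\<in>V. \<bar>d i\<bar>)"
    unfolding T_def by (rule abs_frac_sum_le)
  have "1 - \<alpha> < frac T \<longleftrightarrow> (\<exists>n. \<bar>n\<bar> \<le> (\<Sum>i\<in>V. \<bar>d i\<bar>) + 2 \<and>
    0 \<le> of_int n + T \<and> of_int n - 1 + T < 0 \<and> 0 < of_int n - 1 + \<alpha> + T)" (is "_ \<longleftrightarrow> ?R")
  proof
    assume *: "1 - \<alpha> < frac T"
    have "\<bar>\<lfloor>T\<rfloor>\<bar> \<le> (\<Sum>i\<in>V. \<bar>d i\<bar>) + 2" using bound by linarith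
    then show ?R
      using * frac_lt_1[of T] frac_ge_0[of T] by (intro exI[of _ "- \<lfloor>T\<rfloor>"]) (auto simp: frac_def)
  next
    assume ?R
    then obtain n where n: "0 \<le> of_int n + T" "of_int n - 1 + T < 0" "0 < of_int n - 1 + \<alpha> + T"
      by blast
    then have "\<lfloor>T\<rfloor> = - n" by linarith
    then show "1 - \<alpha> < frac T" using n by (simp add: frac_def)
  qed
  then show ?thesis
    unfolding frac lincomb_lift[OF assms] T_def[symmetric] by simp
qed

lemma similar_lincomb_iff:
  assumes "similar \<Gamma> N M S v v'" "\<forall>i\<in>S. \<bar>k i\<bar> \<le> N"
  shows "lincomb S k v = 0 \<longleftrightarrow> lincomb S k v' = 0" "0 < lincomb S k v \<longleftrightarrow> 0 < lincomb S k v'"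
    "lincomb S k v < 0 \<longleftrightarrow> lincomb S k v' < 0" "0 \<le> lincomb S k v \<longleftrightarrow> 0 \<le> lincomb S k v'"
proof -
  have "sgn (lincomb S k v) = sgn (lincomb S k v')"
    using assms by (simp add: similar_def)
  then show "lincomb S k v = 0 \<longleftrightarrow> lincomb S k v' = 0" "0 < lincomb S k v \<longleftrightarrow> 0 < lincomb S k v'"
    "lincomb S k v < 0 \<longleftrightarrow> lincomb S k v' < 0" "0 \<le> lincomb S k v \<longleftrightarrow> 0 \<le> lincomb S k v'"
    by (auto simp: sgn_if split: if_splits)
qed

lemma case_nat_coeff_bound:
  assumes "finite V" "\<bar>a\<bar> \<le> (\<Sum>i\<in>V. \<bar>d i\<bar>) + 3" "\<bar>b\<bar> \<le> 1"
  shows "\<forall>i\<in>slots V. \<bar>case_nat a (case_nat b d) i\<bar> \<le> (\<Sum>i\<in>V. \<bar>d i\<bar> :: int) + 3"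
proof -
  have "\<bar>d i\<bar> \<le> (\<Sum>i\<in>V. \<bar>d i\<bar>)" if "i \<in> V" for i
    by (rule member_le_sum) (use that assms in auto)
  moreover have "0 \<le> (\<Sum>i\<in>V. \<bar>d i\<bar>)" by (simp add: sum_nonneg)
  ultimately have "\<bar>a\<bar> \<le> (\<Sum>i\<in>V. \<bar>d i\<bar>) + 3" "\<bar>b\<bar> \<le> (\<Sum>i\<in>V. \<bar>d i\<bar>) + 3"
    "\<And>i. i \<in> V \<Longrightarrow> \<bar>d i\<bar> \<le> (\<Sum>i\<in>V. \<bar>d i\<bar>) + 3"
    using assms by (linarith, linarith, fastforce)
  then show ?thesis by (auto simp: slots_def numeral_2_eq_2)
qed

lemma lift_similar_mono:
  assumes "similar \<Gamma> N M (slots V) v v'" "N' \<le> N" "M' dvd M" "finite V" "0 \<le> N"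
  shows "similar \<Gamma> N' M' (slots V) v v'"
  by (rule similar_mono[OF assms(1-3) _ finite_slots \<Gamma>_mult]) (use assms in auto)

lemma lift_similar_sym:
  assumes "similar \<Gamma> N M S v v'"
  shows "similar \<Gamma> N M S v' v"
  unfolding similar_def
proof (intro conjI allI impI ballI)
  show "sgn (lincomb S k v') = sgn (lincomb S k v)" if "\<forall>i\<in>S. \<bar>k i\<bar> \<le> N" for k
    using assms that by (simp add: similar_def)
next
  fix i assume "i \<in> S"
  then obtain g where g: "g \<in> \<Gamma>" "v i - v' i = of_int M * g"
    using assms unfolding similar_def by blast
  then have "v' i - v i = of_int M * (of_int (- 1) * g)" by simp
  then show "\<exists>g\<in>\<Gamma>. v' i - v i = of_int M * g" using \<Gamma>_mult[OF g(1)] by blast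
qed

text \<open>Brings the real witness of \<open>back_and_forth\<close> back to an integer: if g = a
  \<alpha> + b, then \<alpha> (x - a) differs from w by an integer, so y = x - a works.\<close>

lemma frac_of_mem:
  assumes "g \<in> \<Gamma>" "frac (\<alpha> * of_int x) - w = g" "0 \<le> w" "w < 1"
  obtains y :: int where "w = frac (\<alpha> * of_int y)"
proof -
  obtain a b where g: "g = of_int a * \<alpha> + of_int b" using assms by (auto simp: \<Gamma>_def)
  have "frac (\<alpha> * of_int (x - a)) = w"
    unfolding frac_unique_iff
  proof (intro conjI assms)
    have "\<alpha> * of_int (x - a) - w = of_int (\<lfloor>\<alpha> * of_int x\<rfloor> + b)"
      using assms g by (simp add: frac_def algebra_simps)
    then show "\<alpha> * of_int (x - a) - w \<in> \<int>" by (metis Ints_of_int)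
  qed
  then show thesis using that by metis
qed

text \<open>Induction on the formula, with \<open>N\<close> and \<open>M\<close> independent of the
  assignments. \<open>V\<close> contains the bound variables too, so that a quantifier only
  overwrites an existing slot. Each quantifier raises the precision as \<open>back_and_forth\<close>
  demands.\<close>

lemma sat_cong_similar:
  assumes "finite V" "vars \<phi> \<subseteq> V"
  shows "\<exists>N M. 1 \<le> N \<and> 0 < M \<and> (\<forall>e e'. similar \<Gamma> N M (slots V) (lift e) (lift e') \<longrightarrow>
    sat {m. 1 - \<alpha> < frac (\<alpha> * of_int m)} e \<phi> \<longleftrightarrow> sat {m. 1 - \<alpha> < frac (\<alpha> * of_int m)} e' \<phi>)"
    (is "\<exists>N M. _ \<and> _ \<and> (\<forall>e e'. _ \<longrightarrow> sat ?P _ _ \<longleftrightarrow> _)")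
  using assms(2)
proof (induction \<phi>)
  case (Eq s t)
  define d where "d i = mult_of s i - mult_of t i" for i
  define D where "D = (\<Sum>i\<in>V. \<bar>d i\<bar>)"
  have D: "0 \<le> D" by (simp add: D_def sum_nonneg)
  have "sat ?P e (Eq s t) \<longleftrightarrow> (\<Sum>i\<in>V. d i * e i) = 0" for e
    using Eq assms(1) by (simp add: d_def eval_eq_sum left_diff_distrib sum_subtractf)
  moreover have "(\<Sum>i\<in>V. d i * e i) = 0 \<longleftrightarrow> (\<Sum>i\<in>V. d i * e' i) = 0"
    if sim: "similar \<Gamma> (D + 3) 1 (slots V) (lift e) (lift e')" for e e'
  proof -
    have "lincomb (slots V) (case_nat n (case_nat 0 d)) (lift e) = 0 \<longleftrightarrow>
        lincomb (slots V) (case_nat n (case_nat 0 d)) (lift e') = 0" if "\<bar>n\<bar> \<le> D" for n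
      using that
      by (intro similar_lincomb_iff[OF sim] case_nat_coeff_bound[OF assms(1), of _ d, folded D_def]) auto
    then show ?thesis unfolding sum_eq_0_iff[OF assms(1)] D_def[symmetric] by blast
  qed
  ultimately show ?case
    \<comment> \<open>Signs decide atomic formulas; a modulus other than 1 arises only from
      quantifiers.\<close>
    using D by (intro exI[of _ "D + 3"] exI[of _ 1]) auto
next
  case (Pred t)
  define d where "d = mult_of t"
  define D where "D = (\<Sum>i\<in>V. \<bar>d i\<bar>)"
  have D: "0 \<le> D" by (simp add: D_def sum_nonneg)
  have "sat ?P e (Pred t) \<longleftrightarrow> 1 - \<alpha> < frac (\<alpha> * of_int (\<Sum>i\<in>V. d i * e i))" for e
    using Pred assms(1) by (simp add: d_def eval_eq_sum)
  moreover have "1 - \<alpha> < frac (\<alpha> * of_int (\<Sum>i\<in>V. d i * e i)) \<longleftrightarrow>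
      1 - \<alpha> < frac (\<alpha> * of_int (\<Sum>i\<in>V. d i * e' i))"
    if sim: "similar \<Gamma> (D + 3) 1 (slots V) (lift e) (lift e')" for e e'
  proof -
    note b = case_nat_coeff_bound[OF assms(1), of _ d, folded D_def]
    have "0 \<le> lincomb (slots V) (case_nat n (case_nat 0 d)) (lift e) \<longleftrightarrow>
          0 \<le> lincomb (slots V) (case_nat n (case_nat 0 d)) (lift e')"
        "lincomb (slots V) (case_nat (n - 1) (case_nat 0 d)) (lift e) < 0 \<longleftrightarrow>
          lincomb (slots V) (case_nat (n - 1) (case_nat 0 d)) (lift e') < 0"
        "0 < lincomb (slots V) (case_nat (n - 1) (case_nat 1 d)) (lift e) \<longleftrightarrow>
          0 < lincomb (slots V) (case_nat (n - 1) (case_nat 1 d)) (lift e')"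
      if "\<bar>n\<bar> \<le> D + 2" for n
      using that by (intro similar_lincomb_iff[OF sim] b; auto)+
    then show ?thesis
      unfolding frac_sum_gt_iff[OF assms(1)] D_def[symmetric] by blast
  qed
  ultimately show ?case
    using D by (intro exI[of _ "D + 3"] exI[of _ 1]) auto
next
  case (Neg \<phi>)
  then show ?case by simp
next
  case (Conj \<phi> \<psi>)
  obtain N1 M1 where 1: "1 \<le> N1" "0 < M1"
    "\<And>e e'. similar \<Gamma> N1 M1 (slots V) (lift e) (lift e') \<Longrightarrow> sat ?P e \<phi> \<longleftrightarrow> sat ?P e' \<phi>"
    using Conj by auto
  obtain N2 M2 where 2: "1 \<le> N2" "0 < M2"
    "\<And>e e'. similar \<Gamma> N2 M2 (slots V) (lift e) (lift e') \<Longrightarrow> sat ?P e \<psi> \<longleftrightarrow> sat ?P e' \<psi>"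
    using Conj by auto
  have "sat ?P e (Conj \<phi> \<psi>) \<longleftrightarrow> sat ?P e' (Conj \<phi> \<psi>)"
    if "similar \<Gamma> (max N1 N2) (M1 * M2) (slots V) (lift e) (lift e')" for e e'
    using 1(3)[OF lift_similar_mono[OF that]] 2(3)[OF lift_similar_mono[OF that]] 1 2 assms(1)
    by simp
  then show ?case
    using 1 2 by (intro exI[of _ "max N1 N2"] exI[of _ "M1 * M2"]) auto
next
  case (Exists i \<phi>)
  then obtain N M where NM: "1 \<le> N" "0 < M"
    "\<And>e e'. similar \<Gamma> N M (slots V) (lift e) (lift e') \<Longrightarrow> sat ?P e \<phi> \<longleftrightarrow> sat ?P e' \<phi>"
    by auto
  \<comment> \<open>The slot of the quantified variable is dropped because its old value is
    forgotten.\<close>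
  define S where "S = slots V - {i + 2}"
  have S: "finite S" "i + 2 \<notin> S" "insert (i + 2) S = slots V"
    using Exists.prems finite_slots[OF assms(1)] by (auto simp: S_def slots_def)
  have step: "\<exists>y. similar \<Gamma> N M (slots V) (lift (e(i := x))) (lift (e'(i := y)))"
    if sim: "similar \<Gamma> (2 * N * N) (M * fact (nat N)) (slots V) (lift e) (lift e')" for e e' x
  proof -
    define w where "w = frac (\<alpha> * of_int x)"
    have "similar \<Gamma> (2 * N * N) (M * fact (nat N)) S (lift e) (lift e')"
      by (rule similar_mono[OF sim _ _ _ finite_slots \<Gamma>_mult]) (use assms NM in \<open>auto simp: S_def\<close>)
    then obtain w' g where wg: "g \<in> \<Gamma>" "w - w' = of_int M * g"
      and sim': "similar \<Gamma> N M (slots V) ((lift e)(i + 2 := w)) ((lift e')(i + 2 := w'))"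
      using back_and_forth[OF S(1,2) NM(1,2) _ \<Gamma>_zero \<Gamma>_add \<Gamma>_mult \<Gamma>_dense[OF NM(2)]]
      unfolding S(3) by metis
    \<comment> \<open>Slot 0 holds the constant 1, so \<open>c n\<close> represents n + y. The signs
      for n = 0 and n = -1 force \<open>w'\<close> into [0,1), as a fractional part must be.\<close>
    define c where "c n j = (if j = i + 2 then 1 else if j = 0 then n else 0 :: int)" for n and j :: nat
    have c: "lincomb (slots V) (c n) ((lift u)(i + 2 := y)) = of_int n + y" for n u y
    proof -
      have "0 \<in> S" by (simp add: S_def slots_def)
      then have "lincomb S (c n) (lift u) = (\<Sum>j\<in>S. if j = 0 then of_int n else 0)"
        unfolding lincomb_def using S(2)
        by (intro sum.cong) (auto simp: c_def lift_def)
      then have "lincomb S (c n) (lift u) = of_int n"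
        using S \<open>0 \<in> S\<close> by simp
      then show ?thesis
        unfolding S(3)[symmetric] lincomb_insert[OF S(1,2)] lincomb_fun_upd[OF S(2)]
        by (simp add: c_def)
    qed
    have "0 \<le> w' \<and> w' < 1"
      using similar_lincomb_iff(3,4)[OF sim', of "c 0"] similar_lincomb_iff(3,4)[OF sim', of "c (-1)"]
        frac_lt_1[of "\<alpha> * of_int x"] frac_ge_0[of "\<alpha> * of_int x"] NM(1)
      unfolding c by (auto simp: c_def w_def)
    then obtain y where "w' = frac (\<alpha> * of_int y)"
      using frac_of_mem[OF \<Gamma>_mult[OF wg(1)]] wg(2) unfolding w_def by metis
    then show ?thesis using sim' unfolding w_def lift_fun_upd by blast
  qed
  have half: "sat ?P e' (Exists i \<phi>)"
    if "similar \<Gamma> (2 * N * N) (M * fact (nat N)) (slots V) (lift e) (lift e')" "sat ?P e (Exists i \<phi>)"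
    for e e'
    using step[OF that(1)] NM(3) that(2) unfolding sat.simps by blast
  show ?case
  proof (rule exI[of _ "2 * N * N"], rule exI[of _ "M * fact (nat N)"], intro conjI allI impI)
    have "1 * 1 \<le> N * N" using NM by (intro mult_mono) auto
    then show "1 \<le> 2 * N * N" by linarith
    show "0 < M * fact (nat N)" using NM by simp
    fix e e'
    assume sim: "similar \<Gamma> (2 * N * N) (M * fact (nat N)) (slots V) (lift e) (lift e')"
    show "sat ?P e (Exists i \<phi>) \<longleftrightarrow> sat ?P e' (Exists i \<phi>)"
      using half[OF sim] half[OF lift_similar_sym[OF sim]] by (rule iffI)
  qed
qed

section \<open>Bounded gaps\<close>

text \<open>Density gives, for each point i/n of a finite grid, some j > 0 with j \<alpha> close to
  i/n modulo 1. For any u, a grid point near the fractional part of -\<alpha> u supplies the step,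
  and the largest of these finitely many j bounds the gap.\<close>

lemma bounded_gaps:
  assumes "\<delta> > 0"
  obtains K :: int where "1 \<le> K"
    "\<And>u. \<exists>j h. 1 \<le> j \<and> j \<le> K \<and> \<bar>\<alpha> * of_int (u + j) - of_int h\<bar> < \<delta>"
proof -
  obtain n :: nat where n: "n > 0" "1 / n < \<delta> / 2"
    using assms real_arch_inverse[of "\<delta> / 2"] by (auto simp: inverse_eq_divide)
  have "\<exists>j h. j > 0 \<and> \<bar>of_int j * \<alpha> - of_int h - real i / n\<bar> < \<delta> / 2" for i :: nat
  proof -
    have "0 < \<delta> / 2" using assms by simp
    then show ?thesis
      by (rule sequence_of_fractional_parts_is_dense[OF irrational, of _ "real i / n"]) blast
  qed
  then obtain j h where jh: "\<And>i. j i > 0"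
    "\<And>i :: nat. \<bar>of_int (j i) * \<alpha> - of_int (h i) - real i / n\<bar> < \<delta> / 2"
    by metis
  define K where "K = Max (j ` {..n})"
  have K: "j i \<le> K" if "i \<le> n" for i
    unfolding K_def using that by (intro Max_ge) auto
  show thesis
  proof (rule that[of K])
    show "1 \<le> K" using K[of 0] jh(1)[of 0] by simp
    fix u :: int
    define f where "f = frac (- \<alpha> * of_int u)"
    define i where "i = nat \<lfloor>f * n\<rfloor>"
    have f: "0 \<le> f" "f < 1" by (auto simp: f_def frac_lt_1)
    have ri: "real i = of_int \<lfloor>f * n\<rfloor>" using f by (simp add: i_def)
    have "real i \<le> f * n" "f * n < real i + 1" unfolding ri by linarith+
    then have "\<bar>(f * n - real i) / n\<bar> \<le> 1 / n"
      unfolding abs_divide using n by (intro frac_le) auto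
    then have fi: "\<bar>f - real i / n\<bar> \<le> 1 / n"
      using n by (simp add: diff_divide_distrib)
    have "f * n \<le> 1 * real n"
      using f by (intro mult_right_mono) auto
    then have "i \<le> n"
      using \<open>real i \<le> f * n\<close> by linarith
    have "\<alpha> * of_int (u + j i) - of_int (h i - \<lfloor>- \<alpha> * of_int u\<rfloor>) =
        (of_int (j i) * \<alpha> - of_int (h i) - real i / n) - (f - real i / n)"
      by (simp add: f_def frac_def algebra_simps)
    then have "\<bar>\<alpha> * of_int (u + j i) - of_int (h i - \<lfloor>- \<alpha> * of_int u\<rfloor>)\<bar> < \<delta>"
      using jh(2)[of i] fi n(2) by linarith
    moreover have "1 \<le> j i" using jh(1)[of i] by simp
    ultimately show "\<exists>j h. 1 \<le> j \<and> j \<le> K \<and> \<bar>\<alpha> * of_int (u + j) - of_int h\<bar> < \<delta>"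
      using K[OF \<open>i \<le> n\<close>] by blast
  qed
qed

text \<open>Only finitely many integers have their fractional part at a cut point of the parameters,
  so some \<open>x\<^sub>0\<close> in \<open>X\<close> stays at distance at least \<epsilon> from
  all cuts. Adding M u shifts its fractional part by M (\<alpha> u - h), which is too small to cross
  a cut and lies in M \<Gamma>; similarity, hence membership, is preserved.\<close>

lemma definable_contains_bohr_set:
  assumes "infinite X" and "definable {m. 1 - \<alpha> < frac (\<alpha> * of_int m)} X"
  obtains x\<^sub>0 M \<delta> where "0 < M" "0 < \<delta>"
    "\<And>u h. \<bar>\<alpha> * of_int u - of_int h\<bar> < \<delta> \<Longrightarrow> x\<^sub>0 + M * u \<in> X"
proof -
  obtain \<phi> e where X: "X = {x. sat {m. 1 - \<alpha> < frac (\<alpha> * of_int m)} (e(0 := x)) \<phi>}"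
    using assms(2) unfolding definable_def by blast
  define V where "V = insert 0 (vars \<phi>)"
  have V: "finite V" "vars \<phi> \<subseteq> V" by (auto simp: V_def finite_vars)
  obtain N M where NM: "1 \<le> N" "0 < M" and
    cong: "\<And>x y. similar \<Gamma> N M (slots V) (lift (e(0 := x))) (lift (e(0 := y))) \<Longrightarrow>
      x \<in> X \<longleftrightarrow> y \<in> X"
    using sat_cong_similar[OF V] unfolding X by blast
  \<comment> \<open>Slot 2 holds variable 0, the argument of the definable set; all other slots stay
    fixed.\<close>
  define S where "S = slots V - {2}"
  have S: "finite S" "2 \<notin> S" "insert 2 S = slots V"
    using finite_slots[OF V(1)] by (auto simp: S_def slots_def V_def)
  define v where "v = lift e"
  have lift: "lift (e(0 := x)) = v(2 := frac (\<alpha> * of_int x))" for x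
    using lift_fun_upd[of e 0 x] unfolding v_def add_0 .
  \<comment> \<open>The points 0 and 1 are included so that the shifted value stays in [0,1) and is
    again a fractional part.\<close>
  define C where "C = insert 0 (insert 1
    ((\<lambda>(l, m). - l / of_int m) ` ({lincomb S k v | k. \<forall>i\<in>S. \<bar>k i\<bar> \<le> N} \<times> {1..N})))"
  have C: "finite C"
    unfolding C_def by (intro finite.insertI finite_imageI finite_cartesian_product
        finite_lincombs S(1) finite_atLeastAtMost_int)
  have "finite ((\<lambda>x. frac (\<alpha> * real_of_int x)) -` C)"
    by (intro finite_vimageI C inj_frac_multiple)
  then have "\<not> X \<subseteq> (\<lambda>x. frac (\<alpha> * real_of_int x)) -` C"
    using assms(1) finite_subset by blast
  then obtain x\<^sub>0 where x\<^sub>0: "x\<^sub>0 \<in> X" "frac (\<alpha> * of_int x\<^sub>0) \<notin> C"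
    by auto
  define \<theta> where "\<theta> = frac (\<alpha> * of_int x\<^sub>0)"
  obtain \<epsilon> where "0 < \<epsilon>" "\<forall>c\<in>C. c \<noteq> \<theta> \<longrightarrow> \<epsilon> \<le> dist \<theta> c"
    using finite_set_avoid[OF C, of \<theta>] by auto
  moreover have "\<theta> \<notin> C" using x\<^sub>0(2) by (simp add: \<theta>_def)
  ultimately have \<epsilon>: "0 < \<epsilon>" "\<And>c. c \<in> C \<Longrightarrow> \<epsilon> \<le> \<bar>\<theta> - c\<bar>"
    unfolding dist_real_def by auto
  show thesis
  proof (rule that[OF NM(2)])
    show "0 < \<epsilon> / of_int M" using \<epsilon> NM by simp
    fix u h assume "\<bar>\<alpha> * of_int u - of_int h\<bar> < \<epsilon> / of_int M"
    then have "of_int M * \<bar>\<alpha> * of_int u - of_int h\<bar> < \<epsilon>"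
      using NM by (simp add: field_simps)
    define \<theta>' where "\<theta>' = \<theta> + of_int M * (\<alpha> * of_int u - of_int h)"
    have close: "\<bar>\<theta>' - \<theta>\<bar> < \<epsilon>"
      using \<open>of_int M * _ < \<epsilon>\<close> NM by (simp add: \<theta>'_def abs_mult)
    have "\<theta>' = frac (\<alpha> * of_int (x\<^sub>0 + M * u))"
    proof (rule sym, unfold frac_unique_iff, intro conjI)
      have "\<alpha> * of_int (x\<^sub>0 + M * u) - \<theta>' = of_int (\<lfloor>\<alpha> * of_int x\<^sub>0\<rfloor> + M * h)"
        by (simp add: \<theta>'_def \<theta>_def frac_def algebra_simps)
      then show "\<alpha> * of_int (x\<^sub>0 + M * u) - \<theta>' \<in> \<int>" by (metis Ints_of_int)
      have "0 \<le> \<theta>" "\<theta> < 1" by (auto simp: \<theta>_def frac_lt_1)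
      moreover have "\<epsilon> \<le> \<bar>\<theta> - 0\<bar>" "\<epsilon> \<le> \<bar>\<theta> - 1\<bar>"
        by (intro \<epsilon>; simp add: C_def)+
      ultimately show "0 \<le> \<theta>'" "\<theta>' < 1" using close by linarith+
    qed
    moreover have "similar \<Gamma> N M (slots V) (v(2 := \<theta>)) (v(2 := \<theta>'))"
      unfolding S(3)[symmetric]
    proof (rule similar_insertI[OF S(1,2)])
      show "similar \<Gamma> N M S v v"
        unfolding similar_def using \<Gamma>_zero by (auto intro: bexI[of _ 0])
      show "of_int (- u) * \<alpha> + of_int h \<in> \<Gamma>" by (rule \<Gamma>I)
      show "\<theta> - \<theta>' = of_int M * (of_int (- u) * \<alpha> + of_int h)"
        by (simp add: \<theta>'_def algebra_simps)
      fix k m assume "\<forall>i\<in>S. \<bar>k i\<bar> \<le> N" "0 < m" "m \<le> N"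
      then have "(lincomb S k v, m) \<in> {lincomb S k v | k. \<forall>i\<in>S. \<bar>k i\<bar> \<le> N} \<times> {1..N}"
        by auto
      then have "- lincomb S k v / of_int m \<in> C"
        unfolding C_def by force
      from \<epsilon>(2)[OF this] close
      show "sgn (\<theta> - - lincomb S k v / of_int m) = sgn (\<theta>' - - lincomb S k v / of_int m)"
        by (auto simp: sgn_if)
    qed
    ultimately show "x\<^sub>0 + M * u \<in> X"
      using cong[of x\<^sub>0 "x\<^sub>0 + M * u"] x\<^sub>0(1) unfolding lift \<theta>_def by simp
  qed
qed

end

section \<open>Beatty sets as arcs of the rotation by 1/r, and the conclusion\<close>

lemma beatty_eq_frac:
  assumes "r > 1" "r \<notin> \<rat>"
  shows "beatty r = {m. 1 - 1 / r < frac (1 / r * of_int m)}"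
proof -
  \<comment> \<open>Dividing m \<le> n r < m + 1 by r. For n \<noteq> 0 irrationality makes the
    lower bound strict, so n is \<lfloor>m/r\<rfloor> + 1 and the upper bound becomes the condition
    on the fractional part.\<close>
  have iff: "\<lfloor>real_of_int n * r\<rfloor> = m \<longleftrightarrow>
      0 \<le> of_int n - 1 / r * of_int m \<and> of_int n - 1 / r * of_int m < 1 / r" for n m
  proof -
    have "of_int n - 1 / r * of_int m = (of_int n * r - of_int m) / r"
      using assms(1) by (simp add: diff_divide_distrib)
    then show ?thesis
      using assms(1) by (auto simp: floor_eq_iff zero_le_divide_iff divide_less_cancel)
  qed
  have ne: "of_int n \<noteq> 1 / r * of_int m" if "n \<noteq> 0" for n m :: int
  proof
    assume eq: "real_of_int n = 1 / r * of_int m"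
    then have "r = of_int m / of_int n" using that assms(1) by (simp add: field_simps)
    then show False using assms(2) by simp
  qed
  show ?thesis
  proof (intro equalityI subsetI)
    fix m assume "m \<in> beatty r"
    then obtain n where n: "n \<noteq> 0" "\<lfloor>real_of_int n * r\<rfloor> = m" by (auto simp: beatty_def)
    then have "0 < of_int n - 1 / r * of_int m" "of_int n - 1 / r * of_int m < 1 / r"
      using ne[of n m] iff[of n m] by auto
    moreover have "1 / r < 1" using assms by simp
    ultimately have "\<lfloor>1 / r * of_int m\<rfloor> = n - 1" unfolding floor_eq_iff by auto
    then show "m \<in> {m. 1 - 1 / r < frac (1 / r * of_int m)}"
      using \<open>of_int n - 1 / r * of_int m < 1 / r\<close> unfolding frac_def by simp
  next
    fix m assume "m \<in> {m. 1 - 1 / r < frac (1 / r * of_int m)}"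
    then have m: "1 - 1 / r < frac (1 / r * of_int m)" by simp
    define n where "n = \<lfloor>1 / r * of_int m\<rfloor> + 1"
    have "0 < of_int n - 1 / r * of_int m" "of_int n - 1 / r * of_int m < 1 / r"
      using m unfolding n_def frac_def by linarith+
    then have eq: "\<lfloor>real_of_int n * r\<rfloor> = m" using iff by simp
    \<comment> \<open>The index 0 would give m = 0, whose fractional part 0 does not exceed 1 - 1/r
      > 0.\<close>
    moreover have "n \<noteq> 0"
    proof
      assume "n = 0"
      then have "m = 0" using eq by simp
      then show False using m assms by simp
    qed
    ultimately show "m \<in> beatty r" by (auto simp: beatty_def)
  qed
qed

theorem theorem1p1:
  fixes r :: real and X :: "int set"
  assumes "r > 1" and "r \<notin> \<rat>"
    and "infinite X" and "definable (beatty r) X"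
  shows "\<exists>N::nat. N \<ge> 1 \<and> (\<forall>x\<in>X. \<exists>k\<in>{1..N}. x + int k \<in> X)"
proof -
  have "1 / r \<notin> \<rat>"
  proof
    assume "1 / r \<in> \<rat>"
    then have "inverse (1 / r) \<in> \<rat>" by (rule Rats_inverse)
    then show False using assms(2) by simp
  qed
  then interpret irrational_rotation "1 / r" by unfold_locales
  obtain x\<^sub>0 M \<delta> where M: "0 < M" "0 < \<delta>" and
    X: "\<And>u h. \<bar>1 / r * of_int u - of_int h\<bar> < \<delta> \<Longrightarrow> x\<^sub>0 + M * u \<in> X"
    using definable_contains_bohr_set[OF assms(3) assms(4)[unfolded beatty_eq_frac[OF assms(1,2)]]]
    by metis
  obtain K where K: "1 \<le> K"
    "\<And>u. \<exists>j h. 1 \<le> j \<and> j \<le> K \<and> \<bar>1 / r * of_int (u + j) - of_int h\<bar> < \<delta>"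
    using bounded_gaps[OF M(2)] by metis
  have "1 * 1 \<le> M * K" using M K by (intro mult_mono) auto
  then have "1 \<le> nat (M * K)" by linarith
  moreover have "\<exists>k\<in>{1..nat (M * K)}. x + int k \<in> X" for x
  proof -
    define u where "u = (x - x\<^sub>0) div M"
    obtain j h where j: "1 \<le> j" "j \<le> K" "\<bar>1 / r * of_int (u + j) - of_int h\<bar> < \<delta>"
      using K(2) by blast
    \<comment> \<open>Subtracting the remainder moves x + k into the class of
      \<open>x\<^sub>0\<close> modulo \<open>M\<close>. As the remainder is below \<open>M\<close>
      and j \<ge> 1, k is positive; as it is nonnegative, k is at most M K.\<close>
    define k where "k = M * j - (x - x\<^sub>0) mod M"
    have "x - x\<^sub>0 = M * u + (x - x\<^sub>0) mod M" by (simp add: u_def)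
    then have "x + k = x\<^sub>0 + M * (u + j)"
      unfolding k_def by (simp add: distrib_left)
    then have "x + k \<in> X" using X[OF j(3)] by simp
    moreover have "M * 1 \<le> M * j" "M * j \<le> M * K" using j M by (intro mult_left_mono; simp)+
    then have "1 \<le> k" "k \<le> M * K"
      using pos_mod_bound[OF M(1), of "x - x\<^sub>0"] pos_mod_sign[OF M(1), of "x - x\<^sub>0"]
      unfolding k_def by linarith+
    ultimately show ?thesis by (intro bexI[of _ "nat k"]) auto
  qed
  ultimately show ?thesis by blast
qed

end
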